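(* There exists a binary linear code of length $108$, dimension $23$ and minimum distance $36$. *)

theory Defs
  imports "HOL-Analysis.Analysis" "HOL-Library.Z2" "HOL-Library.Numeral_Type"
begin

definition hamming_weight :: "bit ^ 'n \<Rightarrow> nat" where
  "hamming_weight x = card {i. x $ i \<noteq> 0}"

definition hamming_dist :: "bit ^ 'n \<Rightarrow> bit ^ 'n \<Rightarrow> nat" where
  "hamming_dist x y = card {i. x $ i \<noteq> y $ i}"

definition min_distance :: "(bit ^ 'n) set \<Rightarrow> nat" where
  "min_distance C = Min {hamming_dist x y | x y. x \<in> C \<and> y \<in> C \<and> x \<noteq> y}"

definition is_binary_linear_code :: "(bit ^ 'n) set \<Rightarrow> nat \<Rightarrow> nat \<Rightarrow> bool" where
  "is_binary_linear_code C k d \<longleftrightarrow> vec.subspace C \<and> vec.dim C = k \<and> min_distance C = d"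

end

(* The code is quasi-cyclic: it consists of four blocks of length 27 and is invariant under the
simultaneous cyclic shift. The projection to any block is the cyclic code of dimension 21 of all
multiples of x^6 + x^3 + 1, which means that the parities of the columns {i, i + 9, i + 18} of a
block depend only on i mod 3; the kernel of the projection has four elements. A word of weight at
most 35 has a block of weight at most 8. After a cyclic shift that puts a fixed pattern into the
first column, about 6000 such blocks remain for each of the four positions, each with four
completions to a codeword; a backtracking search shows that all of them have weight at least 36. *)

theory Submission
  imports Defs "HOL-Library.Function_Algebras"
begin

text \<open>Over F_2, x^27 - 1 = (x + 1)(x^2 + x + 1)(x^6 + x^3 + 1)(x^18 + x^9 + 1) with
  irreducible factors. The code has no component at the third factor, is one-dimensional at the
  first and the last, and is two-dimensional over F_4 at x^2 + x + 1, whence 23 = 1 + 2 * 2 + 18. A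
  single block sees only one of the two dimensions over F_4; this is why it loses exactly four
  choices. The obstacle is that 2^23 words are too many for evaluation by rewriting. Since any block
  almost determines the word, it is enough to run through light fillings of one block, as in the
  Brouwer-Zimmermann method; the bound 8 comes from 4 * 9 = 36. The parities cut this further: once
  three of them are known, every column has only four fillings left, each with its cost in
  weight.\<close>

declare add_bit_eq_xor [simp del] mult_bit_eq_and [simp del]

section \<open>Words made of four cyclic blocks\<close>

text \<open>\<open>X b i\<close> is the entry at position \<open>i\<close> of block \<open>b\<close>; both block and position are total, with
  period 27 in \<open>i\<close> and zero for \<open>b \<ge> 4\<close>.\<close>

type_synonym cword = "nat \<Rightarrow> nat \<Rightarrow> bit"

definition shift :: "nat \<Rightarrow> cword \<Rightarrow> cword" where
  "shift k X = (\<lambda>b i. X b (i + k))"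

definition word :: "bit list \<Rightarrow> bit list \<Rightarrow> bit list \<Rightarrow> bit list \<Rightarrow> cword" where
  "word p q r s = (\<lambda>b i. if b = 0 then p ! (i mod 27) else if b = 1 then q ! (i mod 27)
     else if b = 2 then r ! (i mod 27) else if b = 3 then s ! (i mod 27) else 0)"

definition vadd :: "bit list \<Rightarrow> bit list \<Rightarrow> bit list" where
  "vadd xs ys = map2 (+) xs ys"

text \<open>\<open>rotate 26\<close> moves a block one place to the right, which is multiplication
  by x modulo x^27 - 1; the recursion is Horner's scheme in the coefficients of the first
  factor.\<close>

fun cmul :: "bit list \<Rightarrow> bit list \<Rightarrow> bit list" where
  "cmul [] ys = replicate 27 0"
| "cmul (x # xs) ys = vadd (map ((*) x) ys) (cmul xs (rotate 26 ys))"

text \<open>Multiplication by the block \<open>s\<close> in \<open>F\<^sub>2[x]/(x^27 - 1)\<close>, written with \<open>26 * i\<close> in place of \<open>- i\<close>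
  to avoid truncated subtraction.\<close>

definition conv :: "(nat \<Rightarrow> bit) \<Rightarrow> cword \<Rightarrow> cword" where
  "conv s Y = (\<lambda>b j. \<Sum>i<27. s i * Y b (j + 26 * i))"

lemma shift_0 [simp]: "shift 0 X = X"
  by (simp add: shift_def)

lemma shift_shift [simp]: "shift j (shift k X) = shift (j + k) X"
  by (simp add: shift_def add.assoc)

lemma shift_add: "shift k (X + Y) = shift k X + shift k Y"
  by (simp add: shift_def fun_eq_iff)

lemma shift_zero [simp]: "shift k 0 = 0"
  by (simp add: shift_def fun_eq_iff)

lemma bit_add_self [simp]: "x + x = (0 :: bit)"
  by (cases x) simp_all

lemma cword_add_self [simp]: "X + X = (0 :: cword)"
  by (simp add: fun_eq_iff)

lemma cword_add_self_left [simp]: "X + (X + Y) = (Y :: cword)"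
  by (simp add: add.assoc [symmetric])

lemma shift_word:
  assumes "length p = 27" "length q = 27" "length r = 27" "length s = 27"
  shows "shift k (word p q r s) = word (rotate k p) (rotate k q) (rotate k r) (rotate k s)"
  using assms by (simp add: shift_def word_def fun_eq_iff nth_rotate mod_simps add.commute)

lemma word_add:
  assumes "length p = 27" "length q = 27" "length r = 27" "length s = 27"
    and "length p' = 27" "length q' = 27" "length r' = 27" "length s' = 27"
  shows "word p q r s + word p' q' r' s' = word (vadd p p') (vadd q q') (vadd r r') (vadd s s')"
  using assms by (simp add: word_def vadd_def fun_eq_iff)

lemma length_vadd [simp]: "length (vadd xs ys) = min (length xs) (length ys)"
  by (simp add: vadd_def)

lemma length_cmul [simp]: "length ys = 27 \<Longrightarrow> length (cmul xs ys) = 27"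
  by (induction xs arbitrary: ys) auto

lemma nth_cmul:
  assumes "length ys = 27" "j < 27"
  shows "cmul xs ys ! j = (\<Sum>i<length xs. xs ! i * ys ! ((j + 26 * i) mod 27))"
  using assms
proof (induction xs arbitrary: ys)
  case (Cons x xs)
  have "rotate 26 ys ! ((j + 26 * i) mod 27) = ys ! ((j + 26 * Suc i) mod 27)" for i
    using Cons.prems by (simp add: nth_rotate mod_simps ac_simps)
  then show ?case
    using Cons by (simp add: vadd_def sum.lessThan_Suc_shift del: sum.lessThan_Suc)
qed simp

lemma conv_word:
  assumes "length t = 27"
    and "length p = 27" "length q = 27" "length r = 27" "length s = 27"
  shows "conv (\<lambda>i. t ! (i mod 27)) (word p q r s) =
    word (cmul t p) (cmul t q) (cmul t r) (cmul t s)"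
proof -
  have "(\<Sum>i<27. t ! (i mod 27) * y ! ((j + 26 * i) mod 27)) = cmul t y ! (j mod 27)"
    if "length y = 27" for y j
    using that assms(1) by (simp add: nth_cmul mod_simps)
  then show ?thesis
    using assms by (auto simp: conv_def word_def fun_eq_iff)
qed

lemma word_block:
  "word p q r s 0 = (\<lambda>i. p ! (i mod 27))" "word p q r s (Suc 0) = (\<lambda>i. q ! (i mod 27))"
  "word p q r s 2 = (\<lambda>i. r ! (i mod 27))" "word p q r s 3 = (\<lambda>i. s ! (i mod 27))"
  by (simp_all add: word_def)

section \<open>The code\<close>

text \<open>The words below were found by a randomized computer search among the doubly-even codes of
  this shape.\<close>

definition Q :: cword where
  "Q = word
    [0, 0, 0, 0, 0, 0, 0, 0, 0, 0, 0, 0, 0, 0, 0, 0, 0, 0, 0, 0, 1, 0, 0, 1, 0, 0, 1]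
    [1, 1, 0, 0, 0, 1, 1, 1, 1, 1, 0, 0, 1, 1, 0, 0, 0, 1, 0, 1, 1, 1, 1, 0, 1, 1, 1]
    [0, 1, 0, 1, 0, 0, 1, 1, 1, 0, 0, 0, 1, 0, 1, 0, 0, 1, 1, 0, 1, 1, 1, 0, 0, 0, 1]
    [1, 0, 1, 0, 0, 0, 0, 1, 0, 1, 1, 1, 0, 0, 1, 0, 1, 0, 1, 0, 1, 1, 1, 0, 1, 1, 1]"

text \<open>The block \<open>p\<close> is (1 + x)(1 + x^3 + ... + x^24), which x^2 + x + 1
  annihilates, so \<open>P b\<close> lives in the component over F_4. It vanishes on the pair of
  blocks (0, 1 or 2, 3) that contains \<open>b\<close>.\<close>

definition P :: "nat \<Rightarrow> cword" where
  "P b = (let p = [1,1,0, 1,1,0, 1,1,0, 1,1,0, 1,1,0, 1,1,0, 1,1,0, 1,1,0, 1,1,0];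
    z = replicate 27 0 in if b < 2 then word z z p p else word p p z z)"

definition R :: "nat \<Rightarrow> cword" where
  "R b =
   (if b = 0 then word
      [1, 0, 0, 1, 0, 0, 1, 0, 0, 0, 0, 0, 1, 0, 0, 1, 0, 0, 0, 0, 0, 1, 0, 0, 1, 0, 0]
      [0, 0, 1, 1, 1, 1, 0, 0, 1, 1, 1, 0, 0, 0, 0, 0, 0, 0, 0, 1, 1, 0, 1, 1, 1, 0, 1]
      [0, 0, 1, 0, 0, 1, 1, 0, 1, 1, 1, 0, 0, 0, 0, 0, 1, 0, 0, 0, 0, 1, 1, 0, 0, 0, 0]
      [0, 0, 0, 1, 1, 0, 0, 0, 0, 0, 1, 0, 0, 1, 1, 0, 1, 0, 1, 0, 1, 0, 1, 0, 1, 0, 1]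
    else if b = 1 then word
      [0, 1, 1, 0, 0, 0, 1, 1, 0, 1, 0, 1, 1, 0, 0, 1, 0, 0, 0, 1, 0, 0, 0, 0, 1, 1, 0]
      [1, 0, 0, 1, 0, 0, 1, 0, 0, 0, 0, 0, 1, 0, 0, 1, 0, 0, 0, 0, 0, 1, 0, 0, 1, 0, 0]
      [0, 0, 1, 0, 0, 0, 1, 1, 0, 1, 1, 0, 1, 0, 1, 1, 1, 0, 0, 0, 0, 0, 1, 0, 1, 1, 1]
      [1, 0, 0, 0, 1, 1, 0, 0, 1, 0, 0, 1, 1, 0, 1, 1, 1, 1, 0, 1, 0, 0, 0, 1, 0, 0, 1]
    else if b = 2 then word
      [0, 1, 1, 0, 1, 1, 1, 0, 1, 1, 1, 0, 0, 0, 1, 1, 0, 0, 0, 1, 0, 1, 0, 1, 1, 1, 0]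
      [0, 0, 0, 1, 1, 0, 1, 1, 0, 0, 1, 0, 1, 1, 0, 1, 1, 1, 1, 0, 1, 1, 1, 1, 1, 1, 0]
      [1, 0, 0, 1, 0, 0, 1, 0, 0, 0, 0, 0, 1, 0, 0, 1, 0, 0, 0, 0, 0, 1, 0, 0, 1, 0, 0]
      [0, 0, 0, 1, 0, 0, 1, 1, 0, 1, 1, 0, 0, 1, 1, 0, 1, 1, 0, 1, 0, 0, 1, 1, 0, 0, 1]
    else word
      [0, 0, 0, 1, 1, 0, 1, 1, 0, 0, 1, 1, 1, 1, 0, 1, 0, 1, 1, 0, 0, 1, 1, 1, 1, 0, 0]
      [0, 1, 0, 1, 0, 0, 0, 1, 1, 1, 1, 0, 1, 1, 0, 1, 1, 0, 0, 1, 1, 1, 0, 1, 0, 1, 0]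
      [0, 1, 0, 1, 0, 1, 0, 1, 0, 0, 0, 1, 0, 1, 0, 1, 1, 1, 1, 1, 1, 0, 1, 1, 0, 0, 1]
      [1, 0, 0, 1, 0, 0, 1, 0, 0, 0, 0, 0, 1, 0, 0, 1, 0, 0, 0, 0, 0, 1, 0, 0, 1, 0, 0])"

lemma vadd_rules:
  "vadd [] ys = []" "vadd (0 # xs) (y # ys) = y # vadd xs ys"
  "vadd (1 # xs) (0 # ys) = 1 # vadd xs ys" "vadd (1 # xs) (1 # ys) = 0 # vadd xs ys"
  by (simp_all add: vadd_def)

lemma numeral_replicate: "replicate (numeral n) x = x # replicate (pred_numeral n) x"
  by (simp add: numeral_eq_Suc)

lemmas word_eval = shift_word word_add rotate_drop_take vadd_rules numeral_replicate

lemma shift_P: "shift 2 (P b) = P b + shift 1 (P b)"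
  by (simp add: P_def Let_def word_eval)

text \<open>The polynomial is (x^27 - 1) / (x^6 + x^3 + 1) = (x^3 + 1)(x^18 + x^9 + 1), which
  annihilates all multiples of x^6 + x^3 + 1. It is its own reciprocal, so the direction of the
  shift does not matter.\<close>

lemma shift_Q: "shift 21 Q = shift 18 Q + (shift 12 Q + (shift 9 Q + (shift 3 Q + Q)))"
  by (simp add: Q_def word_eval)

lemma parity_Q: "shift 3 (Q + shift 9 Q + shift 18 Q) = Q + shift 9 Q + shift 18 Q"
  by (simp add: Q_def word_eval)

lemma parity_P: "shift 3 (P b + shift 9 (P b) + shift 18 (P b)) = P b + shift 9 (P b) + shift 18 (P b)"
  by (simp add: P_def Let_def word_eval)

text \<open>The remainder for blocks 2 and 3 is unavoidable: there both \<open>Q\<close> and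
  \<open>P 0\<close> are visible, their components over F_4 are independent, and the multiples of
  one word \<open>R b\<close> reach only one of them exactly. \<open>R 2\<close> and
  \<open>R 3\<close> are chosen to reproduce \<open>P 0\<close>. In blocks 0 and 1,
  \<open>P 0\<close> is invisible and \<open>R b\<close> can be fitted to \<open>Q\<close>.\<close>

lemma conv_R_Q:
  "conv (Q 0) (R 0) = Q" "conv (Q 1) (R 1) = Q"
  "conv (Q 2) (R 2) + P 2 = Q" "conv (Q 3) (R 3) + P 3 = Q"
  by (simp_all add: Q_def R_def P_def Let_def word_block conv_word word_eval)

lemma conv_R_P: "conv (P 0 2) (R 2) = P 0" "conv (P 0 3) (R 3) = P 0"
  by (simp_all add: P_def Let_def R_def word_block conv_word word_eval)


text \<open>Exactly the 23 basis words are generators, so that the span is immediate; invariance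
  under all shifts is then a consequence of \<open>shift_Q\<close> and
  \<open>shift_P\<close>.\<close>

inductive codeword :: "cword \<Rightarrow> bool" where
  zero: "codeword 0"
| Q: "k < 21 \<Longrightarrow> codeword (shift k Q)"
| P0: "codeword (P 0)"
| P1: "codeword (shift 1 (P 0))"
| add: "codeword X \<Longrightarrow> codeword Y \<Longrightarrow> codeword (X + Y)"

lemma shift_Suc_code: "codeword X \<Longrightarrow> codeword (shift 1 X)"
proof (induction rule: codeword.induct)
  case (Q k)
  show ?case
  proof (cases "k = 20")
    case True
    then have "shift 1 (shift k Q) = shift 21 Q" by simp
    moreover have "codeword Q" using codeword.Q[of 0] by simp
    ultimately show ?thesis
      unfolding shift_Q by (auto intro!: codeword.add codeword.Q simp only:)
  qed (use Q codeword.Q[of "Suc k"] in simp)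
next
  case P1
  have "shift 1 (shift 1 (P 0)) = shift 2 (P 0)" by (simp add: numeral_2_eq_2)
  then show ?case
    unfolding shift_P by (simp only: codeword.add codeword.P0 codeword.P1)
next
  case P0
  then show ?case by (rule codeword.P1)
qed (simp_all only: shift_zero shift_add codeword.zero codeword.add)

lemma shift_code: "codeword X \<Longrightarrow> codeword (shift k X)"
proof (induction k)
  case (Suc k)
  then show ?case using shift_Suc_code[of "shift k X"] by simp
qed simp

text \<open>It suffices to check linear shift-invariant properties on two generators.\<close>

lemma code_shift_induct [consumes 1, case_names zero Q P shift add]:
  assumes "codeword X" "S 0" "S Q" "S (P 0)"
    and shift: "\<And>X. S X \<Longrightarrow> S (shift 1 X)"
    and add: "\<And>X Y. S X \<Longrightarrow> S Y \<Longrightarrow> S (X + Y)"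
  shows "S X"
proof -
  have *: "S (shift k Q)" for k
  proof (induction k)
    case (Suc k)
    then show ?case using shift[of "shift k Q"] by simp
  qed (use assms in simp)
  show ?thesis
    using assms(1)
    by (induction rule: codeword.induct) (rule assms * shift; assumption?)+
qed

lemma periodic_word: "word p q r s b (i + 27) = word p q r s b i"
  by (simp add: word_def)

lemma periodic_Q: "Q b (i + 27) = Q b i" and periodic_P: "P a b (i + 27) = P a b i"
  and periodic_R: "R a b (i + 27) = R a b i"
  by (simp_all only: Q_def P_def R_def Let_def periodic_word split: if_split) simp_all

lemma periodic_code: "codeword X \<Longrightarrow> X b (i + 27) = X b i"
proof (induction arbitrary: i rule: code_shift_induct)
  case (shift X)
  show ?case using shift[of "i + 1"] by (simp add: shift_def add.commute add.left_commute)
qed (simp_all only: periodic_Q periodic_P zero_fun_apply plus_fun_apply)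

definition parity :: "(nat \<Rightarrow> bit) \<Rightarrow> nat \<Rightarrow> bit" where
  "parity s i = s i + s (i + 9) + s (i + 18)"

text \<open>Column parities are the reduction modulo x^9 - 1 = (x^3 - 1)(x^6 + x^3 + 1). A multiple
  of x^6 + x^3 + 1 is annihilated there by x^3 - 1, that is, it has period 3.\<close>

lemma parity_code: "codeword X \<Longrightarrow> parity (X b) (i + 3) = parity (X b) i"
proof -
  assume "codeword X"
  then have "shift 3 (X + shift 9 X + shift 18 X) = X + shift 9 X + shift 18 X"
  proof (induction rule: code_shift_induct)
    case (shift X)
    have "shift 3 (shift 1 X + shift 9 (shift 1 X) + shift 18 (shift 1 X)) =
        shift 1 (shift 3 (X + shift 9 X + shift 18 X))"
      by (simp add: shift_add)
    also have "\<dots> = shift 1 X + shift 9 (shift 1 X) + shift 18 (shift 1 X)"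
      unfolding shift by (simp add: shift_add)
    finally show ?case .
  next
    case (add X Y)
    have "shift 3 (X + Y + shift 9 (X + Y) + shift 18 (X + Y)) =
        shift 3 (X + shift 9 X + shift 18 X) + shift 3 (Y + shift 9 Y + shift 18 Y)"
      by (simp add: shift_add ac_simps)
    also have "\<dots> = X + Y + shift 9 (X + Y) + shift 18 (X + Y)"
      unfolding add by (simp add: shift_add ac_simps)
    finally show ?case .
  qed (simp_all only: parity_Q parity_P shift_zero add_0_left)
  then show ?thesis
    by (auto simp: fun_eq_iff shift_def parity_def ac_simps)
qed

section \<open>Recovering a codeword from one block\<close>

definition kernel_words :: "nat \<Rightarrow> cword list" where
  "kernel_words b = [0, P b, shift 1 (P b), P b + shift 1 (P b)]"

lemma shift_kernel: "e \<in> set (kernel_words b) \<Longrightarrow> shift 1 e \<in> set (kernel_words b)"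
  using shift_P[of b] by (auto simp: kernel_words_def shift_add numeral_2_eq_2 ac_simps)

lemma add_kernel:
  "e \<in> set (kernel_words b) \<Longrightarrow> f \<in> set (kernel_words b) \<Longrightarrow> e + f \<in> set (kernel_words b)"
  by (auto simp: kernel_words_def ac_simps)

lemma conv_add: "conv (\<lambda>i. s i + t i) Y = conv s Y + conv t Y"
  by (simp add: conv_def fun_eq_iff algebra_simps sum.distrib)

lemma conv_0 [simp]: "conv (\<lambda>i. 0) Y = 0"
  by (simp add: conv_def fun_eq_iff)

lemma shift_conv:
  assumes "\<And>i. s (i + 27) = s i" "\<And>b i. Y b (i + 27) = Y b i"
  shows "shift 1 (conv s Y) = conv (\<lambda>i. s (i + 1)) Y"
proof -
  have per: "Y b (i + 27 * k) = Y b i" for b i k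
  proof (induction k)
    case (Suc k)
    then show ?case using assms(2)[of b "i + 27 * k"] by (simp add: ac_simps)
  qed simp
  have "(\<Sum>i<27. s i * Y b (j + 1 + 26 * i)) = (\<Sum>i<27. s (i + 1) * Y b (j + 26 * i))" for b j
  proof -
    define f where "f i = s i * Y b (j + 1 + 26 * i)" for i
    \<comment> \<open>At i = 27 the argument of \<open>Y\<close> has advanced by 26 * 27, a multiple
      of the period, so the cyclic sum may start at 1 instead of 0.\<close>
    have "f 27 = f 0"
      using assms(1)[of 0] per[of b "j + 1" 26] by (simp add: f_def)
    moreover have "(\<Sum>i<27. f i) + f 27 = f 0 + (\<Sum>i<27. f (Suc i))"
      using sum.lessThan_Suc[of f 27] sum.lessThan_Suc_shift[of f 27] by simp
    ultimately have "(\<Sum>i<27. f i) = (\<Sum>i<27. f (Suc i))"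
      by (simp add: add.commute)
    moreover have "f (Suc i) = s (i + 1) * Y b (j + 26 * i)" for i
    proof -
      have "j + 1 + 26 * Suc i = j + 26 * i + 27" by simp
      then show ?thesis unfolding f_def by (metis assms(2) Suc_eq_plus1)
    qed
    ultimately have "(\<Sum>i<27. f i) = (\<Sum>i<27. s (i + 1) * Y b (j + 26 * i))" by simp
    then show ?thesis unfolding f_def .
  qed
  then show ?thesis
    by (simp add: shift_def conv_def fun_eq_iff)
qed

text \<open>The map from a codeword to its block \<open>b\<close> has kernel \<open>kernel_words b\<close>, and multiplication by
  \<open>R b\<close>, whose block \<open>b\<close> is the idempotent generator of the image, is a section of it.\<close>

lemma conv_R_code:
  assumes "codeword X" "b < 4"
  shows "\<exists>e\<in>set (kernel_words b). X = conv (X b) (R b) + e"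
proof -
  have b: "b = 0 \<or> b = 1 \<or> b = 2 \<or> b = 3" using assms(2) by auto
  have zero: "P 0 b = (\<lambda>i. 0)" "P b = P 0" if "b < 2"
    using that by (auto simp: P_def Let_def word_def fun_eq_iff)
  have ker: "0 \<in> set (kernel_words b)" "P b \<in> set (kernel_words b)"
    by (simp_all add: kernel_words_def)
  \<comment> \<open>Periodicity of block \<open>b\<close> is carried along because the shift case
    needs it for \<open>shift_conv\<close>, and the induction does not supply that its words are
    codewords.\<close>
  have "(\<exists>e\<in>set (kernel_words b). X = conv (X b) (R b) + e) \<and> (\<forall>i. X b (i + 27) = X b i)"
    using assms(1)
  proof (induction rule: code_shift_induct)
    case zero
    show ?case using ker(1) by (force simp: zero_fun_def)
  next
    case Q
    have "Q = conv (Q b) (R b) + 0 \<or> Q = conv (Q b) (R b) + P b"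
      using b by (elim disjE) (simp_all only: conv_R_Q add_0_right simp_thms)
    then show ?case using periodic_Q ker by blast
  next
    case P
    have "P 0 = conv (P 0 b) (R b) + 0 \<or> P 0 = conv (P 0 b) (R b) + P b"
    proof (cases "b < 2")
      case True
      then show ?thesis by (simp only: zero conv_0 add_0_left simp_thms)
    next
      case False
      then have "b = 2 \<or> b = 3" using b by auto
      then show ?thesis by (elim disjE) (simp_all only: conv_R_P add_0_right simp_thms)
    qed
    then show ?case using periodic_P ker by blast
  next
    case (shift X)
    then obtain e where e: "e \<in> set (kernel_words b)" "X = conv (X b) (R b) + e" by blast
    have "shift 1 X = shift 1 (conv (X b) (R b)) + shift 1 e"
      unfolding shift_add [symmetric] by (rule arg_cong [where f = "shift 1"]) (rule e)
    also have "shift 1 (conv (X b) (R b)) = conv (shift 1 X b) (R b)"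
      using shift by (subst shift_conv) (simp_all only: periodic_R shift_def)
    finally have "shift 1 X = conv (shift 1 X b) (R b) + shift 1 e" .
    moreover have "shift 1 X b (i + 27) = shift 1 X b i" for i
    proof -
      have "i + 27 + 1 = i + 1 + 27" by simp
      then show ?thesis unfolding shift_def using shift by metis
    qed
    ultimately show ?case using shift_kernel[OF e(1)] by blast
  next
    case (add X Y)
    then obtain e f where ef: "e \<in> set (kernel_words b)" "X = conv (X b) (R b) + e"
      "f \<in> set (kernel_words b)" "Y = conv (Y b) (R b) + f" by blast
    have "X + Y = (conv (X b) (R b) + e) + (conv (Y b) (R b) + f)"
      by (rule arg_cong2[where f = "(+)"]) (rule ef)+
    also have "\<dots> = conv (\<lambda>i. X b i + Y b i) (R b) + (e + f)"
      by (simp only: conv_add add_ac)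
    also have "(\<lambda>i. X b i + Y b i) = (X + Y) b"
      by (simp only: plus_fun_def)
    finally have "X + Y = conv ((X + Y) b) (R b) + (e + f)" .
    moreover have "(X + Y) b (i + 27) = (X + Y) b i" for i
      using add by (simp only: plus_fun_apply)
    ultimately show ?case
      using add_kernel[OF ef(1,3)] by blast
  qed
  then show ?thesis by blast
qed


section \<open>Normalizing a block of small weight\<close>

definition hw :: "(nat \<Rightarrow> bit) \<Rightarrow> nat" where
  "hw s = (\<Sum>i<27. of_bool (s i \<noteq> 0))"

definition weight :: "cword \<Rightarrow> nat" where
  "weight X = (\<Sum>b<4. hw (X b))"

definition col_weight :: "(nat \<Rightarrow> bit) \<Rightarrow> nat \<Rightarrow> nat" where
  "col_weight s c = of_bool (s c \<noteq> 0) + of_bool (s (c + 9) \<noteq> 0) + of_bool (s (c + 18) \<noteq> 0)"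

lemma sum_columns: "(\<Sum>i<27. f i) = (\<Sum>c<9. f c + f (c + 9) + f (c + 18))"
  for f :: "nat \<Rightarrow> 'a :: comm_monoid_add"
proof -
  have "(\<Sum>i<27. f i) = sum f {0..<9} + sum f {0 + 9..<9 + 9} + sum f {0 + 18..<9 + 18}"
    by (simp add: lessThan_atLeast0 sum.atLeastLessThan_concat)
  also have "\<dots> = (\<Sum>c<9. f c + f (c + 9) + f (c + 18))"
    unfolding sum.shift_bounds_nat_ivl by (simp add: lessThan_atLeast0 sum.distrib)
  finally show ?thesis .
qed

lemma hw_columns:
  "hw s = col_weight s 0 + col_weight s 1 + col_weight s 2 + col_weight s 3 + col_weight s 4 +
    col_weight s 5 + col_weight s 6 + col_weight s 7 + col_weight s 8"
  unfolding hw_def col_weight_def sum_columns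
  by (simp add: lessThan_nat_numeral lessThan_Suc)

lemma hw_shift_Suc:
  assumes "\<And>i. s (i + 27) = s i"
  shows "hw (\<lambda>i. s (Suc i)) = hw s"
proof -
  have "s 27 = s 0" using assms[of 0] by simp
  then show ?thesis
    using sum.lessThan_Suc[of "\<lambda>i. of_bool (s i \<noteq> 0) :: nat" 27]
      sum.lessThan_Suc_shift[of "\<lambda>i. of_bool (s i \<noteq> 0) :: nat" 27]
    by (simp add: hw_def)
qed

lemma hw_shift: "codeword X \<Longrightarrow> hw (shift k X b) = hw (X b)"
proof (induction k)
  case (Suc k)
  have "shift (Suc k) X b = (\<lambda>i. shift k X b (Suc i))"
    by (simp add: shift_def)
  then show ?case
    using hw_shift_Suc[of "shift k X b"] periodic_code[OF shift_code[OF Suc.prems]] Suc by metis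
qed simp

lemma weight_shift: "codeword X \<Longrightarrow> weight (shift k X) = weight X"
  by (simp add: weight_def hw_shift)

lemma col_weight_pos: "parity s c \<noteq> 0 \<Longrightarrow> col_weight s c \<ge> 1"
  by (cases "s c"; cases "s (c + 9)"; cases "s (c + 18)") (auto simp: parity_def col_weight_def)

lemma col_weight_odd: "parity s c \<noteq> 0 \<Longrightarrow> col_weight s c \<noteq> 1 \<Longrightarrow> col_weight s c = 3"
  by (cases "s c"; cases "s (c + 9)"; cases "s (c + 18)") (auto simp: parity_def col_weight_def)

text \<open>Every nonzero block of weight at most 8 can be rotated so that column 0 carries
  one of two fixed patterns.\<close>

lemma normalize_block:
  fixes s :: "nat \<Rightarrow> bit"
  assumes periodic: "\<And>i. s (i + 27) = s i"
    and parity: "\<And>i. parity s (i + 3) = parity s i"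
    and weight: "hw s \<le> 8"
    and nonzero: "s i \<noteq> 0"
  obtains (even) k where "s k = 1" "s (k + 9) = 1" "s (k + 18) = 0"
      "parity s k = 0" "parity s (k + 1) = 0" "parity s (k + 2) = 0"
  | (odd) k where "s k = 1" "s (k + 9) = 0" "s (k + 18) = 0"
      "parity s k = 1" "parity s (k + 2) = 0"
proof -
  note par = parity[of 0] parity[of 1] parity[of 2] parity[of 3] parity[of 4] parity[of 5]
  have par_mod: "parity s i = parity s (i mod 3)" for i
  proof (induction i rule: less_induct)
    case (less i)
    show ?case
    proof (cases "i < 3")
      case False
      then show ?thesis
        using less[of "i - 3"] parity[of "i - 3"] by (simp add: le_mod_geq)
    qed simp
  qed
  have per: "s (i + 36) = s (i + 9)" for i
    using periodic[of "i + 9"] by (simp add: add.commute)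
  show thesis
  proof (cases "parity s 0 = 0 \<and> parity s 1 = 0 \<and> parity s 2 = 0")
    case True
    have zero: "parity s j = 0" for j
    proof -
      have "j mod 3 = 0 \<or> j mod 3 = 1 \<or> j mod 3 = 2" by auto
      then show ?thesis using True par_mod[of j] by metis
    qed
    have "s i = 1" using nonzero by simp
    then consider "s (i + 9) = 1" "s (i + 18) = 0" | "s (i + 9) = 0" "s (i + 18) = 1"
      using zero[of i] by (cases "s (i + 9)"; cases "s (i + 18)") (auto simp: parity_def)
    then show thesis
    proof cases
      case 1
      then show thesis using even[of i] zero \<open>s i = 1\<close> by blast
    next
      case 2
      \<comment> \<open>The two ones are at i + 18 and at i + 27, which is i again; read from i + 18
        the column has the wanted pattern.\<close>
      then show thesis
        using even[of "i + 18"] zero \<open>s i = 1\<close> per[of i] periodic[of i] by (simp add: add.assoc)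
    qed
  next
    case False
    \<comment> \<open>With all nine columns odd the weight would be at least 9.\<close>
    have not_all: "\<not> (parity s 0 = 1 \<and> parity s 1 = 1 \<and> parity s 2 = 1)"
    proof
      assume "parity s 0 = 1 \<and> parity s 1 = 1 \<and> parity s 2 = 1"
      then have "parity s c \<noteq> 0" if "c \<in> {0, 1, 2, 3, 4, 5, 6, 7, 8}" for c
        using that par by auto
      then have "col_weight s c \<ge> 1" if "c \<in> {0, 1, 2, 3, 4, 5, 6, 7, 8}" for c
        using that col_weight_pos by blast
      from this[of 0] this[of 1] this[of 2] this[of 3] this[of 4] this[of 5] this[of 6] this[of 7]
        this[of 8] show False
        using weight unfolding hw_columns by simp
    qed
    \<comment> \<open>The three parities form a nonconstant cyclic word, so some one is preceded by
      a zero; j + 2 stands for j - 1 modulo 3.\<close>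
    then obtain j where j: "j < 3" "parity s j = 1" "parity s (j + 2) = 0"
    proof -
      assume *: "\<And>j. j < 3 \<Longrightarrow> parity s j = 1 \<Longrightarrow> parity s (j + 2) = 0 \<Longrightarrow> thesis"
      show thesis
        using False not_all *[of 0] *[of 1] *[of 2] par
        by (cases "parity s 0"; cases "parity s 1"; cases "parity s 2")
          (simp_all add: numeral_3_eq_3 numeral_2_eq_2)
    qed
    have pj: "parity s (j + 3) = 1" "parity s (j + 6) = 1"
      using j parity[of j] parity[of "j + 3"] by (simp_all add: add.commute)
    have "col_weight s j + col_weight s (j + 3) + col_weight s (j + 6) \<le> hw s"
    proof -
      have "j = 0 \<or> j = 1 \<or> j = 2" using j(1) by auto
      then show ?thesis unfolding hw_columns by auto
    qed
    \<comment> \<open>Three full columns would already weigh 9, so some column of the odd class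
      holds a single one.\<close>
    then have "\<not> (col_weight s j = 3 \<and> col_weight s (j + 3) = 3 \<and> col_weight s (j + 6) = 3)"
      using weight by auto
    moreover have "col_weight s c = 1 \<or> col_weight s c = 3" if "parity s c = 1" for c
      using col_weight_odd[of s c] that by auto
    ultimately have "col_weight s (j + 0) = 1 \<or> col_weight s (j + 3) = 1 \<or> col_weight s (j + 6) = 1"
      using j pj by (metis add_0_right)
    then obtain m where m: "m \<in> {0, 3, 6}" "col_weight s (j + m) = 1"
      by blast
    have p: "parity s (j + m) = 1" "parity s (j + m + 2) = 0"
      using m(1) j pj parity[of "j + 2"] parity[of "j + 5"] by (auto simp: add.commute)
    have par9: "parity s (i + 9) = parity s i" for i
      using parity[of i] parity[of "i + 3"] parity[of "i + 6"] by (simp add: add.commute)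
    have p9: "parity s (j + m + 9) = 1" "parity s (j + m + 18) = 1"
       "parity s (j + m + 9 + 2) = 0" "parity s (j + m + 18 + 2) = 0"
      using p par9[of "j + m"] par9[of "j + m + 9"] par9[of "j + m + 2"] par9[of "j + m + 11"]
      by (simp_all add: add.commute add.left_commute)
    have per2: "s (j + m + 27) = s (j + m)" "s (j + m + 36) = s (j + m + 9)"
      using periodic per by auto
    from m(2) consider "s (j + m) = 1" "s (j + m + 9) = 0" "s (j + m + 18) = 0"
      | "s (j + m) = 0" "s (j + m + 9) = 1" "s (j + m + 18) = 0"
      | "s (j + m) = 0" "s (j + m + 9) = 0" "s (j + m + 18) = 1"
      by (cases "s (j + m)"; cases "s (j + m + 9)"; cases "s (j + m + 18)")
        (auto simp: col_weight_def)
    then show thesis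
    proof cases
      case 1
      then show thesis using odd[of "j + m"] p by blast
    next
      case 2
      then show thesis using odd[of "j + m + 9"] p9 per2 by (simp add: add.assoc)
    next
      case 3
      then show thesis using odd[of "j + m + 18"] p9 per2 by (simp add: add.assoc)
    qed
  qed
qed


section \<open>The search\<close>

definition ones :: "bit list \<Rightarrow> nat" where
  "ones xs = length (filter (\<lambda>x. x \<noteq> 0) xs)"

definition others :: "nat \<Rightarrow> nat list" where
  "others b = filter (\<lambda>a. a \<noteq> b) [0, 1, 2, 3]"

text \<open>Only the 81 entries outside block \<open>b\<close> are stored: the weight of block
  \<open>b\<close> itself is accounted for by the budget of the search.\<close>

definition flat :: "nat \<Rightarrow> cword \<Rightarrow> bit list" where
  "flat b X = concat (map (\<lambda>a. map (X a) [0..<27]) (others b))"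

text \<open>Shifting by 26 * i multiplies by x^i, so this is what a one at position \<open>i\<close>
  of block \<open>b\<close> contributes to the other three blocks.\<close>

definition row :: "nat \<Rightarrow> nat \<Rightarrow> bit list" where
  "row b i = flat b (shift (26 * i) (R b))"

text \<open>The sums of two or three rows are tabulated once per column, so that each branch of the
  search costs a single \<open>vadd\<close>.\<close>

datatype column = Even "bit list" "bit list" "bit list" | Odd "bit list" "bit list" "bit list" "bit list"

definition column :: "nat \<Rightarrow> bool \<Rightarrow> nat \<Rightarrow> column" where
  "column b p c = (let x = row b c; y = row b (c + 9); z = row b (c + 18) in
     if p then Odd x y z (vadd x (vadd y z)) else Even (vadd x y) (vadd x z) (vadd y z))"

definition light :: "bit list \<Rightarrow> bit list \<Rightarrow> nat \<Rightarrow> bool" where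
  "light xs ys n \<longleftrightarrow> ones (vadd xs ys) \<le> n"

text \<open>Of the weight budget 8 of a block, \<open>n\<close> is what is left unused; then total weight 35 leaves
  \<open>35 - (8 - n) = 27 + n\<close> for the other three blocks.\<close>

definition heavy :: "bit list list \<Rightarrow> nat \<Rightarrow> bit list \<Rightarrow> bool" where
  "heavy es n a \<longleftrightarrow> (\<forall>e\<in>set es. \<not> light a e (27 + n))"

text \<open>Each column constructor lists the contributions of the admissible nonzero fillings of one
  column to the other three blocks, which are accumulated in \<open>a\<close>.\<close>

fun search :: "bit list list \<Rightarrow> column list \<Rightarrow> nat \<Rightarrow> bit list \<Rightarrow> bool" where
  "search es [] n a = heavy es n a"
| "search es (Even x y z # cs) n a = (search es cs n a \<and>
    (n \<ge> 2 \<longrightarrow> search es cs (n - 2) (vadd a x) \<and> search es cs (n - 2) (vadd a y) \<and>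
      search es cs (n - 2) (vadd a z)))"
| "search es (Odd x y z w # cs) n a =
    ((n \<ge> 1 \<longrightarrow> search es cs (n - 1) (vadd a x) \<and> search es cs (n - 1) (vadd a y) \<and>
      search es cs (n - 1) (vadd a z)) \<and>
     (n \<ge> 3 \<longrightarrow> search es cs (n - 3) (vadd a w)))"

lemma vadd_append: "length xs = length xs' \<Longrightarrow> vadd (xs @ ys) (xs' @ ys') = vadd xs xs' @ vadd ys ys'"
  by (simp add: vadd_def)

lemma flat_add: "flat b (X + Y) = vadd (flat b X) (flat b Y)"
proof -
  have "concat (map (\<lambda>a. map ((X + Y) a) [0..<27]) as) =
    vadd (concat (map (\<lambda>a. map (X a) [0..<27]) as)) (concat (map (\<lambda>a. map (Y a) [0..<27]) as))" for as
    by (induction as) (simp_all add: vadd_append, simp_all add: vadd_def map2_map_map)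
  then show ?thesis by (simp add: flat_def)
qed

lemma weight_blocks: "weight X = hw (X 0) + hw (X (Suc 0)) + hw (X 2) + hw (X 3)"
  by (simp add: weight_def eval_nat_numeral)

lemma ones_flat: "b < 4 \<Longrightarrow> hw (X b) + ones (flat b X) = weight X"
proof -
  assume "b < 4"
  have "ones (map s [0..<n]) = (\<Sum>i<n. of_bool (s i \<noteq> 0))" for s and n :: nat
    by (induction n) (auto simp: ones_def)
  then have "ones (map s [0..<27]) = hw s" for s
    by (simp only: hw_def)
  moreover have "ones (xs @ ys) = ones xs + ones ys" for xs ys
    by (simp add: ones_def)
  moreover have "ones [] = 0" by (simp add: ones_def)
  moreover have "b = 0 \<or> b = 1 \<or> b = 2 \<or> b = 3" using \<open>b < 4\<close> by auto
  ultimately show ?thesis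
    by (elim disjE) (simp_all add: weight_blocks flat_def others_def del: upt_Suc upt_rec_numeral)
qed

section \<open>Splitting a product into column contributions\<close>

definition scale :: "bit \<Rightarrow> cword \<Rightarrow> cword" where
  "scale t X = (\<lambda>b i. t * X b i)"

definition part :: "nat \<Rightarrow> (nat \<Rightarrow> bit) \<Rightarrow> nat \<Rightarrow> cword" where
  "part b s c = scale (s c) (shift (26 * c) (R b)) +
     scale (s (c + 9)) (shift (26 * (c + 9)) (R b)) + scale (s (c + 18)) (shift (26 * (c + 18)) (R b))"

lemma scale_simps [simp]: "scale 0 X = 0" "scale 1 X = X"
  by (simp_all add: scale_def fun_eq_iff)

lemma conv_columns: "conv s (R b) = (\<Sum>c<9. part b s c)"
proof -
  have *: "(\<Sum>c<n. f c) a j = (\<Sum>c<n. f c a j)" for n a j and f :: "nat \<Rightarrow> cword"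
    by (induction n) simp_all
  show ?thesis
    unfolding conv_def sum_columns by (simp add: fun_eq_iff * part_def scale_def shift_def)
qed

text \<open>The columns may be visited in any order. This allows the odd ones to go first: they
  always use up budget, so infeasible branches die before the even columns multiply them.\<close>

lemma conv_column_list:
  assumes "mset cs = mset [1..<9]"
  shows "conv s (R b) = part b s 0 + sum_list (map (part b s) cs)"
    and "hw s = col_weight s 0 + sum_list (map (col_weight s) cs)"
proof -
  have eq: "(\<Sum>c<9. f c) = f 0 + sum_list (map f cs)" for f :: "nat \<Rightarrow> 'a :: comm_monoid_add"
  proof -
    have "sum_list (map f cs) = sum_list (map f [1..<9])"
      using assms by (metis mset_map sum_mset_sum_list)
    also have "\<dots> = (\<Sum>c = 1..<9. f c)"
      by (simp only: sum_set_upt_conv_sum_list_nat[symmetric] set_upt)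
    also have "f 0 + \<dots> = (\<Sum>c<9. f c)"
      by (simp add: lessThan_atLeast0 sum.atLeast_Suc_lessThan)
    finally show ?thesis ..
  qed
  show "conv s (R b) = part b s 0 + sum_list (map (part b s) cs)"
    unfolding conv_columns eq ..
  show "hw s = col_weight s 0 + sum_list (map (col_weight s) cs)"
    unfolding hw_def sum_columns col_weight_def[symmetric] eq ..
qed

text \<open>The eight fillings of a column split by parity into the four even and the four odd ones,
  and each is a branch of the corresponding constructor, the empty filling being the unchanged
  accumulator.\<close>

lemma search_column:
  assumes "search es (column b (parity s c \<noteq> 0) c # cs) n (flat b Z)" "col_weight s c \<le> n"
  shows "search es cs (n - col_weight s c) (flat b (Z + part b s c))"
  using assms
  by (cases "s c"; cases "s (c + 9)"; cases "s (c + 18)")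
    (simp_all add: column_def parity_def col_weight_def part_def row_def Let_def
      numeral_2_eq_2 numeral_3_eq_3 add.assoc flip: flat_add)

text \<open>Invariant: the accumulator is the \<open>flat\<close> image of the columns already
  filled, and \<open>n\<close> is the budget that they left.\<close>

lemma search_sound:
  assumes "search es (map (\<lambda>c. column b (parity s c \<noteq> 0) c) cs) n (flat b Z)"
    and "sum_list (map (col_weight s) cs) \<le> n"
  shows "heavy es (n - sum_list (map (col_weight s) cs)) (flat b (Z + sum_list (map (part b s) cs)))"
  using assms
proof (induction cs arbitrary: n Z)
  case (Cons c cs)
  have "search es (map (\<lambda>c. column b (parity s c \<noteq> 0) c) cs) (n - col_weight s c)
      (flat b (Z + part b s c))"
    by (rule search_column) (use Cons.prems in simp_all)
  from Cons.IH[OF this] Cons.prems show ?case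
    by (simp add: add.assoc)
qed simp


section \<open>Evaluating the search by rewriting\<close>

declare search.simps [simp del]

definition kernel_rows :: "nat \<Rightarrow> bit list list" where
  "kernel_rows b = map (flat b) (kernel_words b)"

lemma map_nth_mod: "length p = 27 \<Longrightarrow> map (\<lambda>i. p ! (i mod 27)) [0..<27] = p"
  by (rule nth_equalityI) (simp_all del: upt_rec_numeral)

lemma flat_word:
  assumes "length p = 27" "length q = 27" "length r = 27" "length s = 27"
  shows "flat 0 (word p q r s) = q @ r @ s" "flat (Suc 0) (word p q r s) = p @ r @ s"
    "flat 2 (word p q r s) = p @ q @ s" "flat 3 (word p q r s) = p @ q @ r"
  using assms
  by (simp_all add: flat_def others_def word_block map_nth_mod del: upt_rec_numeral)

lemma flat_zero: "b < 4 \<Longrightarrow> flat b 0 = replicate 81 0"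
proof -
  assume "b < 4"
  then have "b = 0 \<or> b = 1 \<or> b = 2 \<or> b = 3" by auto
  moreover have "map ((0 :: cword) a) [0..<27] = replicate 27 0" for a
    by (simp add: zero_fun_def map_replicate_const del: upt_rec_numeral)
  ultimately show ?thesis
    by (elim disjE) (simp_all add: flat_def others_def numeral_replicate)
qed

lemmas table_eval = kernel_rows_def kernel_words_def P_def R_def Let_def column_def row_def
  flat_word flat_zero word_eval

lemma search_eval:
  "search es [] n a = heavy es n a"
  "search es (Even x y z # cs) 0 a = search es cs 0 a"
  "search es (Even x y z # cs) (Suc 0) a = search es cs (Suc 0) a"
  "search es (Even x y z # cs) (Suc (Suc n)) a = (search es cs (Suc (Suc n)) a \<and>
    search es cs n (vadd a x) \<and> search es cs n (vadd a y) \<and> search es cs n (vadd a z))"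
  "search es (Odd x y z w # cs) 0 a = True"
  "search es (Odd x y z w # cs) (Suc 0) a = (search es cs 0 (vadd a x) \<and>
    search es cs 0 (vadd a y) \<and> search es cs 0 (vadd a z))"
  "search es (Odd x y z w # cs) (Suc (Suc 0)) a = (search es cs (Suc 0) (vadd a x) \<and>
    search es cs (Suc 0) (vadd a y) \<and> search es cs (Suc 0) (vadd a z))"
  "search es (Odd x y z w # cs) (Suc (Suc (Suc n))) a = (search es cs (Suc (Suc n)) (vadd a x) \<and>
    search es cs (Suc (Suc n)) (vadd a y) \<and> search es cs (Suc (Suc n)) (vadd a z) \<and>
    search es cs n (vadd a w))"
  by (simp_all add: search.simps numeral_2_eq_2 numeral_3_eq_3)

text \<open>The constant 27 is spelled out in successors so that the rules for \<open>light\<close>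
  apply by matching alone, without arithmetic on numerals.\<close>

lemma heavy_eval:
  "heavy [] n a = True"
  "heavy (e # es) n a = (\<not> light a e
    (Suc (Suc (Suc (Suc (Suc (Suc (Suc (Suc (Suc (Suc (Suc (Suc (Suc (Suc (Suc (Suc (Suc (Suc (Suc (Suc (Suc (Suc (Suc (Suc (Suc (Suc (Suc (n))))))))))))))))))))))))))))
    \<and> heavy es n a)"
  by (simp_all add: heavy_def eval_nat_numeral)

text \<open>The allowance drops at each position where the lists differ, so a comparison that
  exceeds it stops there and no weight is ever computed.\<close>

lemma light_eval:
  "light [] ys n = True"
  "light (0 # xs) (0 # ys) n = light xs ys n" "light (1 # xs) (1 # ys) n = light xs ys n"
  "light (0 # xs) (1 # ys) (Suc n) = light xs ys n" "light (1 # xs) (0 # ys) (Suc n) = light xs ys n"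
  "light (0 # xs) (1 # ys) 0 = False" "light (1 # xs) (0 # ys) 0 = False"
  by (simp_all add: light_def vadd_def ones_def)

lemma search_6_7:
  "search es cs 6 a = search es cs (Suc (Suc (Suc (Suc (Suc (Suc 0)))))) a"
  "search es cs 7 a = search es cs (Suc (Suc (Suc (Suc (Suc (Suc (Suc 0))))))) a"
  by (simp_all add: eval_nat_numeral)

text \<open>These congruence rules keep the simplifier from traversing long lists that are already in
  normal form.\<close>

lemma search_cong: "a = a' \<Longrightarrow> search es cs n a = search es cs n a'"
  and heavy_cong: "heavy es n a = heavy es n a"
  and light_cong: "light xs ys n = light xs ys n"
  and vadd_cong: "vadd xs ys = vadd xs ys"
  by simp_all

lemmas search_cong_rules = search_cong heavy_cong light_cong vadd_cong


section \<open>From the search to the weight bound\<close>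

lemma search_weight:
  assumes X: "codeword X" and b: "b < 4" and n: "n + col_weight (X b) 0 = 8"
    and cs: "mset cs = mset [1..<9]" and hw: "hw (X b) \<le> 8"
    and search: "search (kernel_rows b) (map (\<lambda>c. column b (parity (X b) c \<noteq> 0) c) cs) n
      (flat b (part b (X b) 0))"
  shows "weight X \<ge> 36"
proof -
  obtain e where e: "e \<in> set (kernel_words b)" "X = conv (X b) (R b) + e"
    using conv_R_code[OF X b] by blast
  have hw_eq: "hw (X b) = col_weight (X b) 0 + sum_list (map (col_weight (X b)) cs)"
    by (rule conv_column_list(2)[OF cs])
  have "heavy (kernel_rows b) (n - sum_list (map (col_weight (X b)) cs)) (flat b (conv (X b) (R b)))"
    unfolding conv_column_list(1)[OF cs]
    by (rule search_sound[OF search]) (use hw hw_eq n in simp)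
  moreover have "flat b e \<in> set (kernel_rows b)"
    using e(1) by (simp add: kernel_rows_def)
  ultimately have "\<not> light (flat b (conv (X b) (R b))) (flat b e)
      (27 + (n - sum_list (map (col_weight (X b)) cs)))"
    by (simp add: heavy_def)
  moreover have "vadd (flat b (conv (X b) (R b))) (flat b e) = flat b X"
    unfolding flat_add[symmetric] by (rule arg_cong[OF e(2)[symmetric]])
  ultimately have "ones (flat b X) > 27 + (n - sum_list (map (col_weight (X b)) cs))"
    by (simp add: light_def)
  then show ?thesis
    using ones_flat[OF b, of X] hw hw_eq n by simp
qed

lemma hw_nth_mod: "length p = 27 \<Longrightarrow> hw (\<lambda>i. p ! (i mod 27)) = ones p"
proof -
  assume p: "length p = 27"
  have "(\<Sum>i<n. of_bool (f i \<noteq> 0)) = ones (map f [0..<n])" for f :: "nat \<Rightarrow> bit" and n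
    by (induction n) (auto simp: ones_def)
  then show ?thesis
    unfolding hw_def using map_nth_mod[OF p] by metis
qed

lemma weight_word:
  assumes "length p = 27" "length q = 27" "length r = 27" "length s = 27"
  shows "weight (word p q r s) = ones p + ones q + ones r + ones s"
  using assms
  by (simp only: weight_blocks word_block hw_nth_mod)

lemma weight_P: "weight (P b) = 36" "weight (P b + shift 1 (P b)) = 36"
  by (simp_all add: P_def Let_def weight_word word_eval ones_def)

text \<open>This settles words with an empty block, which cannot be normalized: such a word is a
  kernel word, and a nonzero one has two blocks of weight 18.\<close>

lemma weight_kernel: "e \<in> set (kernel_words b) \<Longrightarrow> weight e = 0 \<or> weight e = 36"
proof -
  have "weight (shift 1 (P b)) = 36"
    by (simp add: P_def Let_def weight_word word_eval ones_def)
  moreover have "weight 0 = 0"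
    by (simp add: weight_def hw_def)
  ultimately show "e \<in> set (kernel_words b) \<Longrightarrow> weight e = 0 \<or> weight e = 36"
    using weight_P[of b] by (auto simp only: kernel_words_def list.set insert_iff empty_iff)
qed

text \<open>The first call expands the tables to explicit bit lists with \<open>search\<close> left
  folded; the second one runs the backtracking. For each block the even search has 1789 leaves, the
  odd ones have 1501 (one odd class) and 2835 (two odd classes). The budgets 6 and 7 are 8 minus the
  weight of the fixed column 0.\<close>

lemma search_even_0:
  "search (kernel_rows 0)
    (map (column 0 False) [1, 2, 3, 4, 5, 6, 7, 8]) 6 (vadd (row 0 0) (row 0 9))"
  by (simp add: table_eval, simp only: search_6_7 search_eval heavy_eval light_eval vadd_rules
    simp_thms cong: search_cong_rules)

lemma search_odd_1_0:
  "search (kernel_rows 0)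
    (map (column 0 True) [3, 6] @ map (column 0 False) [1, 2, 4, 5, 7, 8]) 7 (row 0 0)"
  by (simp add: table_eval, simp only: search_6_7 search_eval heavy_eval light_eval vadd_rules
    simp_thms cong: search_cong_rules)

lemma search_odd_2_0:
  "search (kernel_rows 0)
    (map (column 0 True) [3, 6, 1, 4, 7] @ map (column 0 False) [2, 5, 8]) 7 (row 0 0)"
  by (simp add: table_eval, simp only: search_6_7 search_eval heavy_eval light_eval vadd_rules
    simp_thms cong: search_cong_rules)

lemma search_even_1:
  "search (kernel_rows 1)
    (map (column 1 False) [1, 2, 3, 4, 5, 6, 7, 8]) 6 (vadd (row 1 0) (row 1 9))"
  by (simp add: table_eval, simp only: search_6_7 search_eval heavy_eval light_eval vadd_rules
    simp_thms cong: search_cong_rules)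

lemma search_odd_1_1:
  "search (kernel_rows 1)
    (map (column 1 True) [3, 6] @ map (column 1 False) [1, 2, 4, 5, 7, 8]) 7 (row 1 0)"
  by (simp add: table_eval, simp only: search_6_7 search_eval heavy_eval light_eval vadd_rules
    simp_thms cong: search_cong_rules)

lemma search_odd_2_1:
  "search (kernel_rows 1)
    (map (column 1 True) [3, 6, 1, 4, 7] @ map (column 1 False) [2, 5, 8]) 7 (row 1 0)"
  by (simp add: table_eval, simp only: search_6_7 search_eval heavy_eval light_eval vadd_rules
    simp_thms cong: search_cong_rules)

lemma search_even_2:
  "search (kernel_rows 2)
    (map (column 2 False) [1, 2, 3, 4, 5, 6, 7, 8]) 6 (vadd (row 2 0) (row 2 9))"
  by (simp add: table_eval, simp only: search_6_7 search_eval heavy_eval light_eval vadd_rules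
    simp_thms cong: search_cong_rules)

lemma search_odd_1_2:
  "search (kernel_rows 2)
    (map (column 2 True) [3, 6] @ map (column 2 False) [1, 2, 4, 5, 7, 8]) 7 (row 2 0)"
  by (simp add: table_eval, simp only: search_6_7 search_eval heavy_eval light_eval vadd_rules
    simp_thms cong: search_cong_rules)

lemma search_odd_2_2:
  "search (kernel_rows 2)
    (map (column 2 True) [3, 6, 1, 4, 7] @ map (column 2 False) [2, 5, 8]) 7 (row 2 0)"
  by (simp add: table_eval, simp only: search_6_7 search_eval heavy_eval light_eval vadd_rules
    simp_thms cong: search_cong_rules)

lemma search_even_3:
  "search (kernel_rows 3)
    (map (column 3 False) [1, 2, 3, 4, 5, 6, 7, 8]) 6 (vadd (row 3 0) (row 3 9))"
  by (simp add: table_eval, simp only: search_6_7 search_eval heavy_eval light_eval vadd_rules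
    simp_thms cong: search_cong_rules)

lemma search_odd_1_3:
  "search (kernel_rows 3)
    (map (column 3 True) [3, 6] @ map (column 3 False) [1, 2, 4, 5, 7, 8]) 7 (row 3 0)"
  by (simp add: table_eval, simp only: search_6_7 search_eval heavy_eval light_eval vadd_rules
    simp_thms cong: search_cong_rules)

lemma search_odd_2_3:
  "search (kernel_rows 3)
    (map (column 3 True) [3, 6, 1, 4, 7] @ map (column 3 False) [2, 5, 8]) 7 (row 3 0)"
  by (simp add: table_eval, simp only: search_6_7 search_eval heavy_eval light_eval vadd_rules
    simp_thms cong: search_cong_rules)

lemma less_4_cases: "b < 4 \<Longrightarrow> b = 0 \<or> b = 1 \<or> b = 2 \<or> b = (3 :: nat)"
  by auto

lemma search_even:
  "b < 4 \<Longrightarrow> search (kernel_rows b)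
    (map (column b False) [1, 2, 3, 4, 5, 6, 7, 8]) 6 (vadd (row b 0) (row b 9))"
  using search_even_0 search_even_1 search_even_2 search_even_3 less_4_cases[of b] by blast

lemma search_odd_1:
  "b < 4 \<Longrightarrow> search (kernel_rows b)
    (map (column b True) [3, 6] @ map (column b False) [1, 2, 4, 5, 7, 8]) 7 (row b 0)"
  using search_odd_1_0 search_odd_1_1 search_odd_1_2 search_odd_1_3 less_4_cases[of b] by blast

lemma search_odd_2:
  "b < 4 \<Longrightarrow> search (kernel_rows b)
    (map (column b True) [3, 6, 1, 4, 7] @ map (column b False) [2, 5, 8]) 7 (row b 0)"
  using search_odd_2_0 search_odd_2_1 search_odd_2_2 search_odd_2_3 less_4_cases[of b] by blast

lemma weight_normalized:
  assumes X: "codeword X" and b: "b < 4" and hw: "hw (X b) \<le> 8"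
    and normal: "X b 0 = 1" "X b 18 = 0"
      "X b 9 = 1 \<and> parity (X b) 0 = 0 \<and> parity (X b) 1 = 0 \<and> parity (X b) 2 = 0 \<or>
       X b 9 = 0 \<and> parity (X b) 0 = 1 \<and> parity (X b) 2 = 0"
  shows "weight X \<ge> 36"
proof -
  define s where "s = X b"
  have par: "parity s 3 = parity s 0" "parity s 4 = parity s 1" "parity s 5 = parity s 2"
     "parity s 6 = parity s 0" "parity s 7 = parity s 1" "parity s 8 = parity s 2"
    using parity_code[OF X, of b 0] parity_code[OF X, of b 1] parity_code[OF X, of b 2]
      parity_code[OF X, of b 3] parity_code[OF X, of b 4] parity_code[OF X, of b 5]
    by (simp_all add: s_def)
  note normal = normal[folded s_def]
  note concl = search_weight[OF X b _ _ hw, folded s_def]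
  have perm: "mset [1, 2, 3, 4, 5, 6, 7, 8] = mset [1..<9]"
    "mset [3, 6, 1, 2, 4, 5, 7, 8] = mset [1..<9]" "mset [3, 6, 1, 4, 7, 2, 5, 8] = mset [1..<9]"
    by (simp_all add: multiset_eq_iff)
  from normal(3) show ?thesis
  proof (elim disjE conjE)
    assume *: "s 9 = 1" "parity s 0 = 0" "parity s 1 = 0" "parity s 2 = 0"
    have "flat b (part b s 0) = vadd (row b 0) (row b 9)"
      using normal * by (simp add: part_def row_def flat_add[symmetric])
    moreover have "map (\<lambda>c. column b (parity s c \<noteq> 0) c) [1, 2, 3, 4, 5, 6, 7, 8] =
        map (column b False) [1, 2, 3, 4, 5, 6, 7, 8]"
      using * par by simp
    ultimately show ?thesis
      using search_even[OF b] normal *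
      by (intro concl[of 6 "[1, 2, 3, 4, 5, 6, 7, 8]"]) (rule perm | simp add: col_weight_def)+
  next
    assume *: "s 9 = 0" "parity s 0 = 1" "parity s 2 = 0"
    have start: "flat b (part b s 0) = row b 0"
      using normal * by (simp add: part_def row_def)
    show ?thesis
    proof (cases "parity s 1 = 0")
      case True
      have "map (\<lambda>c. column b (parity s c \<noteq> 0) c) [3, 6, 1, 2, 4, 5, 7, 8] =
          map (column b True) [3, 6] @ map (column b False) [1, 2, 4, 5, 7, 8]"
        using * par True by simp
      then show ?thesis
        using search_odd_1[OF b] normal * start
        by (intro concl[of 7 "[3, 6, 1, 2, 4, 5, 7, 8]"]) (rule perm | simp add: col_weight_def)+
    next
      case False
      have "map (\<lambda>c. column b (parity s c \<noteq> 0) c) [3, 6, 1, 4, 7, 2, 5, 8] =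
          map (column b True) [3, 6, 1, 4, 7] @ map (column b False) [2, 5, 8]"
        using * par False by simp
      then show ?thesis
        using search_odd_2[OF b] normal * start
        by (intro concl[of 7 "[3, 6, 1, 4, 7, 2, 5, 8]"]) (rule perm | simp add: col_weight_def)+
    qed
  qed
qed

lemma codeword_weight:
  assumes X: "codeword X" and "weight X \<noteq> 0"
  shows "weight X \<ge> 36"
proof (rule ccontr)
  assume light: "\<not> weight X \<ge> 36"
  have "\<exists>b<4. hw (X b) \<le> 8"
  proof (rule ccontr)
    assume "\<not> (\<exists>b<4. hw (X b) \<le> 8)"
    then have "(\<Sum>b<4::nat. 9) \<le> weight X"
      unfolding weight_def by (intro sum_mono) (auto simp: not_le)
    then show False using light by simp
  qed
  then obtain b where b: "b < 4" "hw (X b) \<le> 8" by blast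
  show False
  proof (cases "\<forall>i. X b i = 0")
    case True
    obtain e where e: "e \<in> set (kernel_words b)" "X = conv (X b) (R b) + e"
      using conv_R_code[OF X b(1)] by blast
    have "X b = (\<lambda>i. 0)" using True by (simp add: fun_eq_iff)
    then have "conv (X b) (R b) = 0" by simp
    then have "X = e" using e(2) by (metis add_0_left)
    then show False using weight_kernel[OF e(1)] assms(2) light by simp
  next
    case False
    then obtain i where i: "X b i \<noteq> 0" by blast
    have heavy: "weight X \<ge> 36"
      if "X b k = 1" "X b (k + 18) = 0" "X b (k + 9) = 1 \<and> parity (X b) k = 0 \<and>
         parity (X b) (k + 1) = 0 \<and> parity (X b) (k + 2) = 0 \<or>
       X b (k + 9) = 0 \<and> parity (X b) k = 1 \<and> parity (X b) (k + 2) = 0" for k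
    proof -
      let ?Y = "shift k X"
      have par: "parity (?Y b) j = parity (X b) (k + j)" for j
        by (simp add: parity_def shift_def ac_simps)
      have "hw (?Y b) = hw (X b)"
        by (rule hw_shift[OF X])
      moreover have "?Y b j = X b (k + j)" for j
        by (simp add: shift_def add.commute)
      ultimately have "weight ?Y \<ge> 36"
        using that b by (intro weight_normalized[OF shift_code[OF X] b(1)]) (simp_all add: par)
      then show ?thesis using weight_shift[OF X] by simp
    qed
    show False
      using normalize_block[OF periodic_code[OF X] parity_code[OF X] b(2) i] heavy light by metis
  qed
qed


section \<open>Dimension and minimum distance\<close>

text \<open>An arbitrary enumeration \<open>h\<close> of the coordinates suffices, since weight and
  independence do not depend on their order.\<close>

definition to_vec :: "('n :: finite \<Rightarrow> nat) \<Rightarrow> cword \<Rightarrow> bit ^ 'n" where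
  "to_vec h X = (\<chi> i. X (h i div 27) (h i mod 27))"

lemma to_vec_add: "to_vec h (X + Y) = to_vec h X + to_vec h Y"
  by (simp add: to_vec_def vec_eq_iff)

lemma to_vec_0: "to_vec h 0 = 0"
  by (simp add: to_vec_def vec_eq_iff)

lemma hamming_weight_to_vec:
  assumes "bij_betw h UNIV {..<108}"
  shows "hamming_weight (to_vec h X) = weight X"
proof -
  define g :: "nat \<Rightarrow> nat" where "g m = of_bool (X (m div 27) (m mod 27) \<noteq> 0)" for m
  have "hamming_weight (to_vec h X) = (\<Sum>i\<in>UNIV. g (h i))"
    by (simp add: hamming_weight_def to_vec_def g_def)
  also have "\<dots> = sum g {..<4 * 27}"
    using sum.reindex_bij_betw[OF assms, of g] by simp
  also have "\<dots> = (\<Sum>b<4. sum g {b * 27..<b * 27 + 27})"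
    by (rule sum.nat_group[symmetric])
  also have "\<dots> = (\<Sum>b<4. \<Sum>i<27. of_bool (X b i \<noteq> 0))"
  proof (rule sum.cong)
    fix b
    show "sum g {b * 27..<b * 27 + 27} = (\<Sum>i<27. of_bool (X b i \<noteq> 0))"
      using sum.shift_bounds_nat_ivl[of g 0 "b * 27" 27]
      by (simp add: lessThan_atLeast0 add.commute g_def)
  qed simp
  finally show ?thesis by (simp add: weight_def hw_def)
qed

fun echelon :: "cword list \<Rightarrow> (nat \<times> nat) list \<Rightarrow> bool" where
  "echelon [] ps = True"
| "echelon (X # Xs) [] = False"
| "echelon (X # Xs) ((b, i) # ps) =
    (b < 4 \<and> i < 27 \<and> X b i = 1 \<and> list_all (\<lambda>Y. Y b i = 0) Xs \<and> echelon Xs ps)"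

text \<open>The coordinate at the pivot of a word vanishes on the span of all later words but not on
  the word itself, so prepending it preserves independence and adds a new element.\<close>

lemma echelon_independent:
  assumes "bij_betw h UNIV {..<108}" "echelon Xs ps"
  shows "vec.independent (set (map (to_vec h) Xs)) \<and> card (set (map (to_vec h) Xs)) = length Xs"
  using assms(2)
proof (induction Xs ps rule: echelon.induct)
  case (3 X Xs b i ps)
  then have "27 * b + i \<in> {..<108}" by simp
  then obtain j where j: "h j = 27 * b + i"
    using assms(1) by (metis bij_betw_imp_surj_on imageE)
  have coord: "to_vec h Y $ j = Y b i" for Y
    using 3 by (simp add: to_vec_def j)
  have "vec.span (set (map (to_vec h) Xs)) \<subseteq> {v. v $ j = 0}"
  proof (rule vec.span_minimal)
    show "set (map (to_vec h) Xs) \<subseteq> {v. v $ j = 0}"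
      using 3 by (auto simp: coord list_all_iff)
    show "vec.subspace {v. v $ j = 0}"
      by (auto simp: vec.subspace_def)
  qed
  then have "to_vec h X \<notin> vec.span (set (map (to_vec h) Xs))"
    using 3 by (auto simp: coord)
  moreover from this have "to_vec h X \<notin> set (map (to_vec h) Xs)"
    using vec.span_base by blast
  ultimately show ?case
    using 3 by (simp add: vec.independent_insert)
qed (simp_all add: vec.independent_empty)

definition basis :: "cword list" where
  "basis = map (\<lambda>k. shift k Q) [0..<21] @ [P 0, shift 1 (P 0)]"

lemma length_basis: "length basis = 23"
  by (simp add: basis_def)

lemma codeword_basis: "X \<in> set basis \<Longrightarrow> codeword X"
  unfolding basis_def using codeword.intros by (auto simp only: set_append set_map list.set Un_iff
    image_iff set_upt atLeastLessThan_iff insert_iff empty_iff)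

text \<open>Block 0 of \<open>Q\<close> is x^20 (1 + x^3 + x^6): its last one is at 26, and
  \<open>shift k\<close> moves it to 26 - k, where larger shifts have only zeros. \<open>P 0\<close>
  vanishes on block 0 and takes its pivots from block 2.\<close>

lemma echelon_basis: "echelon basis (map (\<lambda>k. (0, 26 - k)) [0..<21] @ [(2, 1), (2, 0)])"
proof -
  have upt: "[0..<21] = [0, 1, 2, 3, 4, 5, 6, 7, 8, 9, 10, 11, 12, 13, 14, 15, 16, 17, 18, 19, 20]"
    by (simp add: eval_nat_numeral)
  have Q: "Q 0 i = (replicate 20 0 @ [1, 0, 0, 1, 0, 0, 1]) ! (i mod 27)" for i
    by (simp add: Q_def word_def numeral_replicate)
  have P: "P 0 0 i = 0" "P 0 2 0 = 1" "P 0 2 1 = 1" "P 0 2 2 = 0" for i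
    by (simp_all add: P_def Let_def word_def)
  have shift: "shift k X b i = X b (i + k)" for k X b i
    by (simp add: shift_def)
  show ?thesis
    unfolding basis_def upt by (simp add: shift Q numeral_replicate P[unfolded One_nat_def] numeral_2_eq_2[symmetric])
qed

text \<open>Over F_2 a scalar is 0 or 1, so closure under addition already gives the linear
  span.\<close>

lemma span_basis: "vec.span (to_vec h ` set basis) = to_vec h ` Collect codeword"
proof
  have "\<exists>X. codeword X \<and> v = to_vec h X" if "v \<in> vec.span (to_vec h ` set basis)" for v
    using that
  proof (induction rule: vec.span_induct_alt)
    case base
    show ?case using codeword.zero to_vec_0 by metis
  next
    case (step c x y)
    then obtain X Y where XY: "codeword X" "x = to_vec h X" "codeword Y" "y = to_vec h Y"
      using codeword_basis by blast
    show ?case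
    proof (cases "c = 0")
      case True
      then show ?thesis using XY by auto
    next
      case False
      then have "c *s x + y = to_vec h (X + Y)" using XY by (simp add: to_vec_add)
      then show ?thesis using XY codeword.add by blast
    qed
  qed
  then show "vec.span (to_vec h ` set basis) \<subseteq> to_vec h ` Collect codeword" by blast
  have "to_vec h X \<in> vec.span (to_vec h ` set basis)" if "codeword X" for X
    using that
  proof (induction rule: codeword.induct)
    case zero
    show ?case unfolding to_vec_0 by (rule vec.span_zero)
  next
    case (add X Y)
    then show ?case unfolding to_vec_add by (intro vec.span_add)
  qed (auto simp: basis_def intro!: vec.span_base)
  then show "to_vec h ` Collect codeword \<subseteq> vec.span (to_vec h ` set basis)" by blast
qed

lemma hamming_dist_eq: "hamming_dist x y = hamming_weight (x + y)"
proof -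
  have "x $ i \<noteq> y $ i \<longleftrightarrow> (x + y) $ i \<noteq> 0" for i
    by (cases "x $ i"; cases "y $ i") simp_all
  then show ?thesis by (simp only: hamming_dist_def hamming_weight_def)
qed

theorem theorem5p2:
  shows "\<exists>C :: (bit ^ 108) set. is_binary_linear_code C 23 36"
proof -
  obtain h :: "108 \<Rightarrow> nat" where h: "bij_betw h UNIV {..<108}"
    using ex_bij_betw_finite_nat[of "UNIV :: 108 set"] by (auto simp: atLeast0LessThan)
  define C where "C = vec.span (to_vec h ` set basis)"
  have indep: "vec.independent (to_vec h ` set basis)" "card (to_vec h ` set basis) = 23"
    using echelon_independent[OF h echelon_basis] unfolding set_map
    by (simp_all add: length_basis)
  have sub: "vec.subspace C"
    unfolding C_def by (rule vec.subspace_span)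
  have dim: "vec.dim C = 23"
    unfolding C_def using vec.dim_span_eq_card_independent[OF indep(1)] indep(2) by simp
  have heavy: "hamming_weight x \<ge> 36" if x: "x \<in> C" "x \<noteq> 0" for x
  proof -
    obtain X where X: "codeword X" "x = to_vec h X"
      using x(1) unfolding C_def span_basis by blast
    have "hamming_weight x \<noteq> 0"
      using x(2) by (auto simp: hamming_weight_def vec_eq_iff)
    then show ?thesis
      using codeword_weight[OF X(1)] X(2) hamming_weight_to_vec[OF h] by metis
  qed
  have "min_distance C = 36"
    unfolding min_distance_def
  proof (rule Min_eqI)
    have "hamming_dist x y \<le> CARD(108)" for x y :: "bit ^ 108"
      unfolding hamming_dist_def by (rule card_mono) simp_all
    then have "{hamming_dist x y |x y. x \<in> C \<and> y \<in> C \<and> x \<noteq> y} \<subseteq> {..CARD(108)}" by blast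
    then show "finite {hamming_dist x y |x y. x \<in> C \<and> y \<in> C \<and> x \<noteq> y}"
      by (rule finite_subset) simp
  next
    fix d assume "d \<in> {hamming_dist x y |x y. x \<in> C \<and> y \<in> C \<and> x \<noteq> y}"
    then obtain x y where xy: "d = hamming_dist x y" "x \<in> C" "y \<in> C" "x \<noteq> y" by blast
    have "d = hamming_weight (x + y)" by (simp only: xy(1) hamming_dist_eq)
    moreover have "x + y \<in> C" using sub xy by (simp add: vec.subspace_add)
    moreover have "x + y \<noteq> 0"
    proof
      assume "x + y = 0"
      then have "hamming_dist x y = 0" by (simp add: hamming_dist_eq hamming_weight_def)
      then show False using xy(4) by (simp add: hamming_dist_def vec_eq_iff)
    qed
    ultimately show "d \<ge> 36" using heavy by blast
  next
    \<comment> \<open>The bound is attained by the kernel word \<open>P 0\<close>, whose two nonzero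
      blocks have weight 18 each.\<close>
    have "to_vec h (P 0) \<in> C"
      unfolding C_def by (intro vec.span_base imageI) (simp add: basis_def)
    moreover have "0 \<in> C" using sub by (rule vec.subspace_0)
    moreover have dist: "hamming_dist (to_vec h (P 0)) 0 = 36"
      using hamming_weight_to_vec[OF h, of "P 0"] weight_P(1)[of 0] by (simp add: hamming_dist_eq)
    moreover from dist have "to_vec h (P 0) \<noteq> 0"
      by (auto simp: hamming_dist_def)
    ultimately show "36 \<in> {hamming_dist x y |x y. x \<in> C \<and> y \<in> C \<and> x \<noteq> y}"
      by (metis (mono_tags, lifting) mem_Collect_eq)
  qed
  then show ?thesis
    unfolding is_binary_linear_code_def using sub dim by blast
qed

end
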